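(* For $i=1,2$ let $f_i\in L^1(\mathbb{R}^N)$, $f_i\ge0$ a.e.; if $N=1$ or $N=2$, assume in addition that $J$ is nonincreasing in the radial variable and that, for each $i$, $0\le f_i\le g_i$ a.e. for some $g_i\in L^1(\mathbb{R}^N)\cap C_0(\mathbb{R}^N)$, $g_i\ge0$, radial and strictly decreasing in the radial variable. Let $w_i$ be the solution of the nonlocal obstacle problem (OP) with data $f_i$ and $\tilde f_i=f_i+J*w_i-w_i$. Then $$\|\tilde f_1-\tilde f_2\|_{L^1(\mathbb{R}^N)}\le\|f_1-f_2\|_{L^1(\mathbb{R}^N)} .$$
   Context: Standing assumptions: $J:\mathbb{R}^N\to[0,\infty)$ is continuous, compactly supported, radially symmetric, and $\int_{\mathbb{R}^N}J=1$. Here $*$ is convolution. $C_0(\mathbb{R}^N)$ is the set of continuous functions tending to $0$ at infinity. Nonlocal obstacle problem (OP): given a nonnegative $f\in L^1(\mathbb{R}^N)$, find a nonnegative $w\in L^1(\mathbb{R}^N)$ such that $$0\le f+J*w-w\le1,\qquad (f+J*w-w-1)\,w=0\quad\text{a.e.}$$ Under the hypotheses of the claim this problem has exactly one solution for each $f_i$. *)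

theory Defs
  imports "HOL-Analysis.Analysis"
begin

definition radial :: "(real ^ 'n \<Rightarrow> real) \<Rightarrow> bool" where
  "radial g \<longleftrightarrow> (\<forall>x y. norm x = norm y \<longrightarrow> g x = g y)"

definition radially_nonincreasing :: "(real ^ 'n \<Rightarrow> real) \<Rightarrow> bool" where
  "radially_nonincreasing g \<longleftrightarrow> (\<forall>x y. norm x \<le> norm y \<longrightarrow> g y \<le> g x)"

definition radially_strictly_decreasing :: "(real ^ 'n \<Rightarrow> real) \<Rightarrow> bool" where
  "radially_strictly_decreasing g \<longleftrightarrow> (\<forall>x y. norm x < norm y \<longrightarrow> g y < g x)"

definition kernel :: "(real ^ 'n \<Rightarrow> real) \<Rightarrow> bool" where
  "kernel J \<longleftrightarrow>
     (\<forall>x. 0 \<le> J x) \<and> continuous_on UNIV J \<and> compact (closure {x. J x \<noteq> 0}) \<and>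
     radial J \<and> (LINT x|lebesgue. J x) = 1"

definition C0 :: "(real ^ 'n \<Rightarrow> real) set" where
  "C0 = {g. continuous_on UNIV g \<and> (g \<longlongrightarrow> 0) at_infinity}"

definition conv :: "(real ^ 'n \<Rightarrow> real) \<Rightarrow> (real ^ 'n \<Rightarrow> real) \<Rightarrow> real ^ 'n \<Rightarrow> real" where
  "conv J w x = (LINT y|lebesgue. J (x - y) * w y)"

text \<open>
  The norm takes values in the extended nonnegative reals, so that it is infinite (rather
  than 0, as for the Bochner integral) for measurable functions that are not integrable.
\<close>
definition L1_norm :: "(real ^ 'n \<Rightarrow> real) \<Rightarrow> ennreal" where
  "L1_norm u = (\<integral>\<^sup>+ x. ennreal \<bar>u x\<bar> \<partial>lebesgue)"

definition solves_OP :: "(real ^ 'n \<Rightarrow> real) \<Rightarrow> (real ^ 'n \<Rightarrow> real) \<Rightarrow> (real ^ 'n \<Rightarrow> real) \<Rightarrow> bool" where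
  "solves_OP J f w \<longleftrightarrow>
     integrable lebesgue w \<and> (AE x in lebesgue. 0 \<le> w x) \<and>
     (AE x in lebesgue. 0 \<le> f x + conv J w x - w x \<and> f x + conv J w x - w x \<le> 1) \<and>
     (AE x in lebesgue. (f x + conv J w x - w x - 1) * w x = 0)"

text \<open>Data that are dominated by a radial, strictly decreasing function; needed in low dimension.\<close>
definition radially_dominated :: "(real ^ 'n \<Rightarrow> real) \<Rightarrow> bool" where
  "radially_dominated f \<longleftrightarrow>
     (\<exists>g. integrable lebesgue g \<and> g \<in> C0 \<and> (\<forall>x. 0 \<le> g x) \<and>
          radial g \<and> radially_strictly_decreasing g \<and>
          (AE x in lebesgue. 0 \<le> f x \<and> f x \<le> g x))"

end

(*
Let w = w1 - w2, F = f1 - f2 and G = ft1 - ft2 = F + J * w - w. Where w > 0 we have w1 > 0, so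
ft1 = 1 >= ft2 and G >= 0; symmetrically G <= 0 where w < 0. Hence |G| + |w| <= |F| + |J * w|
almost everywhere. Integrate and cancel, using that convolution with J does not increase the L1 norm.
*)
theory Submission
  imports Defs
begin

lemma kernel_bounded:
  assumes "kernel J"
  obtains B where "\<And>x. \<bar>J x\<bar> \<le> B"
proof -
  let ?K = "closure {x. J x \<noteq> 0}"
  have "compact (J ` ?K)"
    using assms unfolding kernel_def
    by (intro compact_continuous_image) (auto intro: continuous_on_subset)
  then obtain B where B: "\<And>x. x \<in> ?K \<Longrightarrow> \<bar>J x\<bar> \<le> B"
    using compact_imp_bounded[of "J ` ?K"] by (auto simp: bounded_iff)
  \<comment> \<open>\<open>B\<close> is controlled only on the support and could be negative if the
    support is empty; the maximum with 0 covers the points where J vanishes.\<close>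
  have "\<bar>J x\<bar> \<le> max B 0" for x
    using B[of x] closure_subset[of "{x. J x \<noteq> 0}"] by (cases "J x = 0") auto
  then show thesis by (rule that)
qed

lemma kernel_borel_measurable:
  "kernel J \<Longrightarrow> J \<in> borel_measurable borel"
  unfolding kernel_def by (blast intro: borel_measurable_continuous_onI)

lemma kernel_nn_integral:
  assumes "kernel J"
  shows "(\<integral>\<^sup>+ x. ennreal (J x) \<partial>lborel) = 1"
proof -
  note [measurable] = kernel_borel_measurable[OF assms]
  have "(LINT x|lborel. J x) = 1"
    using assms by (simp add: kernel_def integral_completion)
  \<comment> \<open>The Bochner integral of a non-integrable function is 0, so the value 1 forces
    integrability.\<close>
  moreover from this have "integrable lborel J"
    using not_integrable_integral_eq by fastforce
  ultimately show ?thesis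
    using assms by (subst nn_integral_eq_integral) (auto simp: kernel_def)
qed

lemma nn_integral_lborel_translate:
  fixes f :: "'a::euclidean_space \<Rightarrow> ennreal"
  assumes [measurable]: "f \<in> borel_measurable borel"
  shows "(\<integral>\<^sup>+ x. f (c + x) \<partial>lborel) = (\<integral>\<^sup>+ x. f x \<partial>lborel)"
proof -
  have "(\<integral>\<^sup>+ x. f x \<partial>lborel) = (\<integral>\<^sup>+ x. f x \<partial>distr lborel borel ((+) c))"
    by (simp add: lborel_distr_plus)
  also have "\<dots> = (\<integral>\<^sup>+ x. f (c + x) \<partial>lborel)"
    by (rule nn_integral_distr) auto
  finally show ?thesis ..
qed

text \<open>Since J is bounded, a constant multiple of w dominates the integrand. Hence the
  convolution is a genuine integral at every point, not merely almost everywhere, and is linear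
  there.\<close>

lemma integrable_kernel_mult:
  assumes J: "kernel J" and w: "integrable lebesgue w"
  shows "integrable lebesgue (\<lambda>y. J (x - y) * w y)"
proof -
  obtain B where B: "\<And>x. \<bar>J x\<bar> \<le> B" using kernel_bounded[OF J] by blast
  note [measurable] = kernel_borel_measurable[OF J]
  have "(\<lambda>y. J (x - y)) \<in> borel_measurable lborel" by measurable
  then have [measurable]: "(\<lambda>y. J (x - y)) \<in> borel_measurable lebesgue"
    by (rule measurable_completion)
  have [measurable]: "w \<in> borel_measurable lebesgue" using w by simp
  show ?thesis
  proof (rule Bochner_Integration.integrable_bound)
    show "integrable lebesgue (\<lambda>y. B * w y)" using w by simp
    show "AE y in lebesgue. norm (J (x - y) * w y) \<le> norm (B * w y)"
      by (intro AE_I2) (auto simp: abs_mult intro!: mult_right_mono order_trans[OF B])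
  qed measurable
qed

lemma conv_diff:
  assumes "kernel J" "integrable lebesgue v" "integrable lebesgue w"
  shows "conv J (\<lambda>x. v x - w x) x = conv J v x - conv J w x"
  using integrable_kernel_mult[OF assms(1,2), of x] integrable_kernel_mult[OF assms(1,3), of x]
  unfolding conv_def by (simp add: right_diff_distrib)

text \<open>With a Borel u in place of w, the integrand \<open>J (x - y) * u y\<close> is jointly
  Borel in (x, y), as parameter integrals and Tonelli over \<open>lborel\<close> require. The
  exceptional null set in y does not depend on x, so the convolution is unchanged at every
  x.\<close>

lemma borel_representative:
  assumes J: "kernel J" and w: "w \<in> borel_measurable lebesgue"
  obtains u where "u \<in> borel_measurable borel" "AE x in lebesgue. w x = u x"
    "\<And>x. conv J w x = (LINT y|lborel. J (x - y) * u y)"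
proof -
  obtain u where u [measurable]: "u \<in> borel_measurable lborel"
    and "AE x in lborel. w x = u x"
    using completion_ex_borel_measurable_real[OF w] by blast
  then have eq: "AE x in lebesgue. w x = u x" by (intro AE_completion)
  have [measurable]: "u \<in> borel_measurable borel" using u by simp
  note [measurable] = kernel_borel_measurable[OF J]
  have "conv J w x = (LINT y|lborel. J (x - y) * u y)" for x
  proof -
    have Jm: "(\<lambda>y. J (x - y)) \<in> borel_measurable lborel" by measurable
    have m: "(\<lambda>y. J (x - y) * u y) \<in> borel_measurable lborel" by measurable
    have "conv J w x = (LINT y|lebesgue. J (x - y) * u y)"
      unfolding conv_def using eq
      by (intro integral_cong_AE borel_measurable_times w measurable_completion[OF Jm]
            measurable_completion[OF u]) auto
    also have "\<dots> = (LINT y|lborel. J (x - y) * u y)"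
      by (rule integral_completion[OF m])
    finally show ?thesis .
  qed
  then show thesis using that eq \<open>u \<in> borel_measurable borel\<close> by blast
qed

lemma conv_measurable:
  assumes "kernel J" "w \<in> borel_measurable lebesgue"
  shows "conv J w \<in> borel_measurable borel"
proof -
  obtain u where [measurable]: "u \<in> borel_measurable borel"
    and u: "\<And>x. conv J w x = (LINT y|lborel. J (x - y) * u y)"
    using borel_representative[OF assms] by blast
  note [measurable] = kernel_borel_measurable[OF assms(1)]
  have "(\<lambda>x. LINT y|lborel. J (x - y) * u y) \<in> borel_measurable borel"
    by (rule lborel.borel_measurable_lebesgue_integral) measurable
  then show ?thesis using u by presburger
qed

text \<open>This is Young's inequality for an L1 kernel of mass one: bring the absolute value
  inside, swap the integrals, and integrate the kernel first. Both sides may be infinite, so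
  measurability of w suffices.\<close>

lemma L1_norm_conv_le:
  assumes J: "kernel J" and w: "w \<in> borel_measurable lebesgue"
  shows "L1_norm (conv J w) \<le> L1_norm w"
proof -
  obtain u where [measurable]: "u \<in> borel_measurable borel"
    and eq: "AE x in lebesgue. w x = u x"
    and u: "\<And>x. conv J w x = (LINT y|lborel. J (x - y) * u y)"
    using borel_representative[OF J w] by blast
  note [measurable] = kernel_borel_measurable[OF J] conv_measurable[OF J w]
  have J0: "0 \<le> J x" for x using J by (simp add: kernel_def)
  have bound: "ennreal \<bar>conv J w x\<bar> \<le> (\<integral>\<^sup>+ y. ennreal (J (x - y)) * ennreal \<bar>u y\<bar> \<partial>lborel)" for x
  proof (cases "integrable lborel (\<lambda>y. J (x - y) * u y)")
    case True
    then have "ennreal (norm (LINT y|lborel. J (x - y) * u y))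
        \<le> (\<integral>\<^sup>+ y. ennreal (norm (J (x - y) * u y)) \<partial>lborel)"
      by (rule integral_norm_bound_ennreal)
    then show ?thesis by (simp add: u abs_mult J0 ennreal_mult)
  next
    \<comment> \<open>Here the Bochner integral defaults to 0, so the bound is trivial.\<close>
    case False
    then show ?thesis by (simp add: u not_integrable_integral_eq)
  qed
  have "L1_norm (conv J w) = (\<integral>\<^sup>+ x. ennreal \<bar>conv J w x\<bar> \<partial>lborel)"
    unfolding L1_norm_def by (rule nn_integral_completion)
  also have "\<dots> \<le> (\<integral>\<^sup>+ x. \<integral>\<^sup>+ y. ennreal (J (x - y)) * ennreal \<bar>u y\<bar> \<partial>lborel \<partial>lborel)"
    by (intro nn_integral_mono bound)
  also have "\<dots> = (\<integral>\<^sup>+ y. \<integral>\<^sup>+ x. ennreal (J (x - y)) * ennreal \<bar>u y\<bar> \<partial>lborel \<partial>lborel)"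
    by (rule lborel_pair.Fubini') measurable
  \<comment> \<open>The factor in u is constant in x and leaves the inner integral. What remains is
    a translate of J by \<open>- y\<close>, whose integral is 1.\<close>
  also have "\<dots> = (\<integral>\<^sup>+ y. (\<integral>\<^sup>+ x. ennreal (J (- y + x)) \<partial>lborel) * ennreal \<bar>u y\<bar> \<partial>lborel)"
    by (simp add: nn_integral_multc)
  also have "\<dots> = (\<integral>\<^sup>+ y. ennreal \<bar>u y\<bar> \<partial>lborel)"
    by (subst nn_integral_lborel_translate[where f = "\<lambda>x. ennreal (J x)"])
      (simp_all add: kernel_nn_integral[OF J])
  also have "\<dots> = (\<integral>\<^sup>+ y. ennreal \<bar>u y\<bar> \<partial>lebesgue)"
    by (rule nn_integral_completion[symmetric])
  also have "\<dots> = L1_norm w"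
    unfolding L1_norm_def using eq by (intro nn_integral_cong_AE) auto
  finally show ?thesis .
qed

theorem corollary5p5:
  fixes J f1 f2 w1 w2 ft1 ft2 :: "real ^ 'n \<Rightarrow> real"
  assumes "kernel J"
    and "integrable lebesgue f1" and "AE x in lebesgue. 0 \<le> f1 x"
    and "integrable lebesgue f2" and "AE x in lebesgue. 0 \<le> f2 x"
    and "CARD('n) = 1 \<or> CARD('n) = 2 \<Longrightarrow>
           radially_nonincreasing J \<and> radially_dominated f1 \<and> radially_dominated f2"
    and "solves_OP J f1 w1" and "solves_OP J f2 w2"
    and "ft1 = (\<lambda>x. f1 x + conv J w1 x - w1 x)"
    and "ft2 = (\<lambda>x. f2 x + conv J w2 x - w2 x)"
  shows "L1_norm (\<lambda>x. ft1 x - ft2 x) \<le> L1_norm (\<lambda>x. f1 x - f2 x)"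
proof -
  note J = assms(1) and ft = assms(9,10)
  define w where "w = (\<lambda>x. w1 x - w2 x)"
  define F where "F = (\<lambda>x. f1 x - f2 x)"
  define G where "G = (\<lambda>x. ft1 x - ft2 x)"
  have w12: "integrable lebesgue w1" "integrable lebesgue w2"
    using assms(7,8) by (auto simp: solves_OP_def)
  then have w: "integrable lebesgue w" by (simp add: w_def)
  have [measurable]: "w \<in> borel_measurable lebesgue" "F \<in> borel_measurable lebesgue"
    using w assms(2,4) by (auto simp: F_def)
  have "conv J w \<in> borel_measurable lborel"
    using conv_measurable[OF J, of w] by simp
  then have [measurable]: "conv J w \<in> borel_measurable lebesgue"
    by (rule measurable_completion)
  have G: "G = (\<lambda>x. F x + conv J w x - w x)"
    unfolding w_def conv_diff[OF J w12] by (auto simp: G_def F_def ft)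
  have [measurable]: "G \<in> borel_measurable lebesgue"
    unfolding G by measurable
  have "AE x in lebesgue. \<bar>G x\<bar> + \<bar>w x\<bar> \<le> \<bar>F x\<bar> + \<bar>conv J w x\<bar>"
    \<comment> \<open>Integrability is split off, and the remaining conditions on each solution are
      merged into a single almost-everywhere statement.\<close>
    using assms(7)[unfolded solves_OP_def, THEN conjunct2] assms(8)[unfolded solves_OP_def, THEN conjunct2]
    unfolding eventually_conj_iff[symmetric]
  proof eventually_elim
    case (elim x)
    have ft_bounds: "ft1 x \<le> 1" "ft2 x \<le> 1" "ft1 x = 1 \<or> w1 x = 0" "ft2 x = 1 \<or> w2 x = 0"
      using elim by (auto simp: ft)
    then have "w x > 0 \<Longrightarrow> G x \<ge> 0" "w x < 0 \<Longrightarrow> G x \<le> 0"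
      using elim by (auto simp: w_def G_def)
    moreover have "G x = F x + conv J w x - w x" by (simp add: G)
    \<comment> \<open>G and w never have strictly opposite signs, so |G| + |w| = |G + w|. Since G +
      w = F + J * w, the triangle inequality finishes.\<close>
    ultimately show ?case by linarith
  qed
  then have "(\<integral>\<^sup>+ x. ennreal \<bar>G x\<bar> + ennreal \<bar>w x\<bar> \<partial>lebesgue)
      \<le> (\<integral>\<^sup>+ x. ennreal \<bar>F x\<bar> + ennreal \<bar>conv J w x\<bar> \<partial>lebesgue)"
    by (intro nn_integral_mono_AE) (auto simp flip: ennreal_plus)
  then have "L1_norm G + L1_norm w \<le> L1_norm F + L1_norm (conv J w)"
    unfolding L1_norm_def by (simp add: nn_integral_add)
  also have "\<dots> \<le> L1_norm F + L1_norm w"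
    by (intro add_left_mono L1_norm_conv_le J) simp
  finally have "L1_norm w + L1_norm G \<le> L1_norm w + L1_norm F"
    by (simp add: add.commute)
  \<comment> \<open>Cancelling a summand in \<open>ennreal\<close> is valid only if it is finite;
    this is where the integrability of both solutions enters.\<close>
  moreover have "L1_norm w \<noteq> top"
    using w by (auto simp: L1_norm_def integrable_iff_bounded)
  ultimately show ?thesis
    by (simp add: ennreal_add_left_cancel_le G_def F_def)
qed

end
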